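(* Let $p\ge0$ and $S=\{\lambda_n,\alpha_n\}_{n\ge1}\in\mathcal S_p$. Define $A(S)=\#\{n\ge1:\alpha_n=0\}$; $\mathcal I(S)=\{n\ge1:(n=1\text{ or }\lambda_n\neq\lambda_k\text{ for all }k<n)\text{ and }\alpha_n\neq0\}$; for $k\in\mathcal I(S)$, $m_k=\#\{n\ge1:\lambda_n=\lambda_k\text{ and }\alpha_n\neq0\}$; and $B(S)=\sum_{k\in\mathcal I(S)}(m_k-1)$ (a finite sum). If $A(S)+B(S)\ge p+1$, then the operator $E+\tilde H(\pi)$ is not invertible on $m$.
   Context: $\mathcal S_p$: collections $S=\{\lambda_n,\alpha_n\}_{n\ge1}$ of complex numbers with $\rho_n:=\sqrt{\lambda_n}$ ($\arg\rho_n\in[-\pi/2,\pi/2)$), $\rho_n=n-p-1+\varkappa_n$, $\alpha_n=2/\pi+\kappa_n$, $\{\varkappa_n\},\{\kappa_n\}\in l_2$. Model data: $\tilde\rho_n=0$ for $n\le p+1$, $\tilde\rho_n=n-p-1$ for $n\ge p+1$, $\tilde\lambda_n=\tilde\rho_n^2$; $\tilde\alpha_1=1/\pi$, $\tilde\alpha_n=0$ for $2\le n\le p+1$, $\tilde\alpha_n=2/\pi$ for $n\ge p+2$. Operator $\tilde H(x)$ built from $S$: $\lambda_{n0}=\lambda_n,\rho_{n0}=\rho_n,\alpha_{n0}=\alpha_n$, $\lambda_{n1}=\tilde\lambda_n,\rho_{n1}=\tilde\rho_n,\alpha_{n1}=\tilde\alpha_n$, $\hat\rho_n=\rho_n-\tilde\rho_n$;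 $\tilde D(x,\lambda,\mu)=\int_0^x\cos(\sqrt\lambda t)\cos(\sqrt\mu t)dt$; $\tilde Q_{ni,kj}(x)=\alpha_{kj}\tilde D(x,\rho_{ni}^2,\rho_{kj}^2)$; $\tilde Q_{nk}=\begin{pmatrix}\tilde Q_{n0,k0}&-\tilde Q_{n0,k1}\\ \tilde Q_{n1,k0}&-\tilde Q_{n1,k1}\end{pmatrix}$; $T_k^{-1}=\begin{pmatrix}\hat\rho_k&1\\0&1\end{pmatrix}$; for $\hat\rho_n\neq0$, $T_n=\begin{pmatrix}\hat\rho_n^{-1}&-\hat\rho_n^{-1}\\0&1\end{pmatrix}$ and $\tilde H_{nk}=T_n\tilde Q_{nk}T_k^{-1}$; for $\hat\rho_n=0$, $\tilde H_{nk}=\begin{pmatrix}\partial_\rho[\alpha_{k0}\tilde D(x,\rho^2,\lambda_{k0})]_{\rho=\rho_{n0}}&-\partial_\rho[\alpha_{k1}\tilde D(x,\rho^2,\lambda_{k1})]_{\rho=\rho_{n0}}\\ \tilde Q_{n1,k0}&-\tilde Q_{n1,k1}\end{pmatrix}T_k^{-1}$. $m$: Banach space of bounded sequences $(a_{ni})_{n\ge1,i=0,1}$ with sup norm; $(\tilde H(x)a)_n=\sum_k\tilde H_{nk}(x)a_k$, $a_k=(a_{k0},a_{k1})^T$; $E$ identity. *)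

theory Defs
  imports "HOL-Analysis.Analysis"
begin

(* Sequences S = {lambda_n, alpha_n}_{n>=1} are functions nat => complex; index 0 is ignored. *)

(* rho = sqrt lambda with arg rho in [-pi/2, pi/2) *)
definition rho_of :: "complex \<Rightarrow> complex" where
  "rho_of z = (if Re (csqrt z) = 0 \<and> Im (csqrt z) > 0 then - csqrt z else csqrt z)"

definition in_Sp :: "nat \<Rightarrow> (nat \<Rightarrow> complex) \<Rightarrow> (nat \<Rightarrow> complex) \<Rightarrow> bool" where
  "in_Sp p lam alp \<longleftrightarrow>
     (\<exists>varkappa kappa :: nat \<Rightarrow> complex.
        summable (\<lambda>n. (cmod (varkappa n))\<^sup>2) \<and> summable (\<lambda>n. (cmod (kappa n))\<^sup>2) \<and>
        (\<forall>n\<ge>1. rho_of (lam n) = of_int (int n - int p - 1) + varkappa n \<and>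
                 alp n = complex_of_real (2 / pi) + kappa n))"

definition rho_t :: "nat \<Rightarrow> nat \<Rightarrow> complex" where
  "rho_t p n = (if n \<le> p + 1 then 0 else of_nat (n - p - 1))"

definition lam_t :: "nat \<Rightarrow> nat \<Rightarrow> complex" where
  "lam_t p n = (rho_t p n)\<^sup>2"

definition alpha_t :: "nat \<Rightarrow> nat \<Rightarrow> complex" where
  "alpha_t p n = (if n = 1 then complex_of_real (1 / pi)
                  else if n \<le> p + 1 then 0 else complex_of_real (2 / pi))"

definition lamj :: "nat \<Rightarrow> (nat \<Rightarrow> complex) \<Rightarrow> nat \<Rightarrow> nat \<Rightarrow> complex" where
  "lamj p lam n j = (if j = 0 then lam n else lam_t p n)"

definition rhoj :: "nat \<Rightarrow> (nat \<Rightarrow> complex) \<Rightarrow> nat \<Rightarrow> nat \<Rightarrow> complex" where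
  "rhoj p lam n j = (if j = 0 then rho_of (lam n) else rho_t p n)"

definition alphaj :: "nat \<Rightarrow> (nat \<Rightarrow> complex) \<Rightarrow> nat \<Rightarrow> nat \<Rightarrow> complex" where
  "alphaj p alp n j = (if j = 0 then alp n else alpha_t p n)"

definition rho_hat :: "nat \<Rightarrow> (nat \<Rightarrow> complex) \<Rightarrow> nat \<Rightarrow> complex" where
  "rho_hat p lam n = rho_of (lam n) - rho_t p n"

definition Dt :: "real \<Rightarrow> complex \<Rightarrow> complex \<Rightarrow> complex" where
  "Dt x l mu = integral {0..x}
     (\<lambda>t::real. cos (csqrt l * complex_of_real t) * cos (csqrt mu * complex_of_real t))"

definition Qt :: "nat \<Rightarrow> (nat \<Rightarrow> complex) \<Rightarrow> (nat \<Rightarrow> complex) \<Rightarrow> real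
                  \<Rightarrow> nat \<Rightarrow> nat \<Rightarrow> nat \<Rightarrow> nat \<Rightarrow> complex" where
  "Qt p lam alp x n i k j =
     alphaj p alp k j * Dt x ((rhoj p lam n i)\<^sup>2) ((rhoj p lam k j)\<^sup>2)"

definition mat2 :: "complex \<Rightarrow> complex \<Rightarrow> complex \<Rightarrow> complex \<Rightarrow> nat \<Rightarrow> nat \<Rightarrow> complex" where
  "mat2 a b c d i j = (if i = 0 then (if j = 0 then a else b) else (if j = 0 then c else d))"

definition mmul2 :: "(nat \<Rightarrow> nat \<Rightarrow> complex) \<Rightarrow> (nat \<Rightarrow> nat \<Rightarrow> complex) \<Rightarrow> nat \<Rightarrow> nat \<Rightarrow> complex" where
  "mmul2 A B i j = (\<Sum>l<2. A i l * B l j)"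

definition Qmat :: "nat \<Rightarrow> (nat \<Rightarrow> complex) \<Rightarrow> (nat \<Rightarrow> complex) \<Rightarrow> real
                    \<Rightarrow> nat \<Rightarrow> nat \<Rightarrow> nat \<Rightarrow> nat \<Rightarrow> complex" where
  "Qmat p lam alp x n k =
     mat2 (Qt p lam alp x n 0 k 0) (- Qt p lam alp x n 0 k 1)
          (Qt p lam alp x n 1 k 0) (- Qt p lam alp x n 1 k 1)"

definition Tinv :: "nat \<Rightarrow> (nat \<Rightarrow> complex) \<Rightarrow> nat \<Rightarrow> nat \<Rightarrow> nat \<Rightarrow> complex" where
  "Tinv p lam k = mat2 (rho_hat p lam k) 1 0 1"

definition Tm :: "nat \<Rightarrow> (nat \<Rightarrow> complex) \<Rightarrow> nat \<Rightarrow> nat \<Rightarrow> nat \<Rightarrow> complex" where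
  "Tm p lam n = mat2 (1 / rho_hat p lam n) (- 1 / rho_hat p lam n) 0 1"

definition Hblock :: "nat \<Rightarrow> (nat \<Rightarrow> complex) \<Rightarrow> (nat \<Rightarrow> complex) \<Rightarrow> real
                      \<Rightarrow> nat \<Rightarrow> nat \<Rightarrow> nat \<Rightarrow> nat \<Rightarrow> complex" where
  "Hblock p lam alp x n k =
     (if rho_hat p lam n \<noteq> 0 then
        mmul2 (mmul2 (Tm p lam n) (Qmat p lam alp x n k)) (Tinv p lam k)
      else
        mmul2 (mat2
                 (deriv (\<lambda>r. alphaj p alp k 0 * Dt x (r\<^sup>2) (lamj p lam k 0)) (rhoj p lam n 0))
                 (- deriv (\<lambda>r. alphaj p alp k 1 * Dt x (r\<^sup>2) (lamj p lam k 1)) (rhoj p lam n 0))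
                 (Qt p lam alp x n 1 k 0) (- Qt p lam alp x n 1 k 1))
              (Tinv p lam k))"

(* the space m: bounded sequences (a_{ni})_{n>=1, i=0,1}, represented as nat => nat => complex
   vanishing outside n >= 1, i < 2 *)
definition mseq :: "(nat \<Rightarrow> nat \<Rightarrow> complex) \<Rightarrow> bool" where
  "mseq a \<longleftrightarrow> (\<forall>n i. (n = 0 \<or> 2 \<le> i) \<longrightarrow> a n i = 0) \<and> (\<exists>B. \<forall>n i. cmod (a n i) \<le> B)"

definition mnorm :: "(nat \<Rightarrow> nat \<Rightarrow> complex) \<Rightarrow> real" where
  "mnorm a = Sup {cmod (a n i) | n i. 1 \<le> n \<and> i < 2}"

definition Hop :: "nat \<Rightarrow> (nat \<Rightarrow> complex) \<Rightarrow> (nat \<Rightarrow> complex) \<Rightarrow> real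
                   \<Rightarrow> (nat \<Rightarrow> nat \<Rightarrow> complex) \<Rightarrow> nat \<Rightarrow> nat \<Rightarrow> complex" where
  "Hop p lam alp x a n i =
     (if 1 \<le> n \<and> i < 2 then
        (\<Sum>k. \<Sum>j<2. Hblock p lam alp x n (Suc k) i j * a (Suc k) j)
      else 0)"

definition EpH :: "nat \<Rightarrow> (nat \<Rightarrow> complex) \<Rightarrow> (nat \<Rightarrow> complex) \<Rightarrow> real
                   \<Rightarrow> (nat \<Rightarrow> nat \<Rightarrow> complex) \<Rightarrow> nat \<Rightarrow> nat \<Rightarrow> complex" where
  "EpH p lam alp x a n i = a n i + Hop p lam alp x a n i"

definition invertible_on_m :: "((nat \<Rightarrow> nat \<Rightarrow> complex) \<Rightarrow> (nat \<Rightarrow> nat \<Rightarrow> complex)) \<Rightarrow> bool" where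
  "invertible_on_m F \<longleftrightarrow>
     (\<exists>G. (\<forall>a. mseq a \<longrightarrow> mseq (G a) \<and> G (F a) = a \<and> F (G a) = a) \<and>
          (\<exists>C. \<forall>a. mseq a \<longrightarrow> mnorm (G a) \<le> C * mnorm a))"

definition A_S :: "(nat \<Rightarrow> complex) \<Rightarrow> nat" where
  "A_S alp = card {n. 1 \<le> n \<and> alp n = 0}"

definition I_S :: "(nat \<Rightarrow> complex) \<Rightarrow> (nat \<Rightarrow> complex) \<Rightarrow> nat set" where
  "I_S lam alp = {n. 1 \<le> n \<and> (n = 1 \<or> (\<forall>k. 1 \<le> k \<and> k < n \<longrightarrow> lam n \<noteq> lam k)) \<and> alp n \<noteq> 0}"

definition mult_S :: "(nat \<Rightarrow> complex) \<Rightarrow> (nat \<Rightarrow> complex) \<Rightarrow> nat \<Rightarrow> nat" where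
  "mult_S lam alp k = card {n. 1 \<le> n \<and> lam n = lam k \<and> alp n \<noteq> 0}"

(* B(S) = sum_{k in I(S)} (m_k - 1); only the finitely many terms with m_k >= 2 are nonzero *)
definition B_S :: "(nat \<Rightarrow> complex) \<Rightarrow> (nat \<Rightarrow> complex) \<Rightarrow> nat" where
  "B_S lam alp = (\<Sum>k\<in>{k \<in> I_S lam alp. 2 \<le> mult_S lam alp k}. mult_S lam alp k - 1)"

end

theory Submission
  imports Defs "HOL-Complex_Analysis.Great_Picard"
begin

text \<open>
  If \<open>f\<close> on \<open>[0, \<pi>]\<close> is orthogonal to \<open>cos (\<rho>\<^sub>n t)\<close> whenever \<open>\<alpha>\<^sub>n \<noteq> 0\<close>, and
  \<open>F (\<rho>) = \<integral> f(t) cos (\<rho> t) dt\<close>, then \<open>b\<^sub>n\<^sub>i = F (\<rho>\<^sub>n\<^sub>i)\<close> satisfies \<open>\<alpha>\<^sub>n b\<^sub>n\<^sub>0 = 0\<close>; only the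
  model part of the system survives, and it is the cosine expansion of \<open>f\<close>.  Hence
  \<open>a\<^sub>n = T\<^sub>n b\<^sub>n\<close> lies in the kernel of \<open>E + H(\<pi>)\<close>.  Here \<open>f\<close> is represented by the square summable
  sequence of its cosine coefficients \<open>F (l)\<close>, \<open>l \<ge> 0\<close>.

  Such an \<open>f \<noteq> 0\<close> exists because \<open>A + B \<ge> p + 1\<close> leaves at most one condition for each
  \<open>m \<ge> 1\<close>, with node close to \<open>m\<close> in the square summable sense, whereas there is an unknown for each
  \<open>m \<ge> 0\<close>: truncating to \<open>l \<le> L\<close> gives a homogeneous linear system with more unknowns than
  equations, and Bessel's inequality confines its normalised solutions to a fixed Hilbert cube, so that
  a subsequence converges in norm as \<open>L \<rightarrow> \<infinity>\<close>.
\<close>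

subsection \<open>Linear systems and counting of nodes\<close>

text \<open>Gaussian elimination, one equation at a time: a nonzero coefficient of the new equation
  serves as pivot, which costs one unknown, so the surplus of unknowns survives the
  induction.\<close>

lemma homogeneous_system_nontrivial_solution:
  fixes A :: "'i \<Rightarrow> 'j \<Rightarrow> 'a::field"
  assumes "finite I" "finite J" "card I < card J"
  shows "\<exists>x. (\<exists>j\<in>J. x j \<noteq> 0) \<and> (\<forall>i\<in>I. (\<Sum>j\<in>J. A i j * x j) = 0)"
  using assms
proof (induction I arbitrary: J A rule: finite_induct)
  case empty
  then obtain j where "j \<in> J"
    by (metis card.empty less_irrefl ex_in_conv)
  then show ?case
    by (intro exI[of _ "\<lambda>_. 1"]) auto
next
  case (insert i0 I)
  show ?case
  proof (cases "\<forall>j\<in>J. A i0 j = 0")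
    case True
    have "card I < card J"
      using insert by simp
    from insert.IH[OF insert.prems(1) this, of A] obtain x where
      "\<exists>j\<in>J. x j \<noteq> 0" "\<forall>i\<in>I. (\<Sum>j\<in>J. A i j * x j) = 0"
      by blast
    with True show ?thesis
      by (intro exI[of _ x]) simp
  next
    case False
    then obtain j0 where j0: "j0 \<in> J" "A i0 j0 \<noteq> 0"
      by blast
    define A' where "A' i j = A i j - A i j0 * A i0 j / A i0 j0" for i j
    have "card I < card (J - {j0})"
      using insert j0 by simp
    from insert.IH[OF _ this, of A'] obtain x where
      x: "\<exists>j\<in>J - {j0}. x j \<noteq> 0" "\<And>i. i \<in> I \<Longrightarrow> (\<Sum>j\<in>J - {j0}. A' i j * x j) = 0"
      using insert.prems by auto
    define s where "s = (\<Sum>j\<in>J - {j0}. A i0 j * x j)"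
    \<comment> \<open>Back substitution: the pivot unknown is chosen so that equation
      \<open>i0\<close> holds.\<close>
    define y where "y = x(j0 := - s / A i0 j0)"
    have split: "(\<Sum>j\<in>J. A i j * y j) = - A i j0 * s / A i0 j0 + (\<Sum>j\<in>J - {j0}. A i j * x j)" for i
    proof -
      have "(\<Sum>j\<in>J. A i j * y j) = A i j0 * y j0 + (\<Sum>j\<in>J - {j0}. A i j * y j)"
        using insert.prems j0 by (simp add: sum.remove)
      also have "(\<Sum>j\<in>J - {j0}. A i j * y j) = (\<Sum>j\<in>J - {j0}. A i j * x j)"
        by (intro sum.cong) (auto simp: y_def)
      finally show ?thesis by (simp add: y_def)
    qed
    have "(\<Sum>j\<in>J. A i j * y j) = 0" if "i \<in> I" for i
    proof -
      have "0 = (\<Sum>j\<in>J - {j0}. A i j * x j - A i j0 / A i0 j0 * (A i0 j * x j))"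
        using x(2)[OF that] by (simp add: A'_def algebra_simps)
      also have "\<dots> = (\<Sum>j\<in>J - {j0}. A i j * x j) - A i j0 / A i0 j0 * s"
        by (simp add: sum_subtractf sum_distrib_left s_def)
      finally show ?thesis
        unfolding split by simp
    qed
    moreover have "(\<Sum>j\<in>J. A i0 j * y j) = 0"
      unfolding split using j0 by (simp add: s_def)
    moreover have "\<exists>j\<in>J. y j \<noteq> 0"
      using x(1) by (auto simp: y_def)
    ultimately show ?thesis by blast
  qed
qed

text \<open>From the indices up to \<open>N\<close>, discard those with \<open>alp n = 0\<close> and
  all but the first occurrence of each node counted in \<open>B_S\<close>. Every node with
  \<open>alp n \<noteq> 0\<close> keeps a representative, and once \<open>N\<close> exceeds all
  discarded indices, exactly \<open>A_S alp + B_S lam alp\<close> of them are gone. Equality may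
  fail, as \<open>I_S\<close> ignores a node whose first occurrence has
  \<open>alp n = 0\<close>.\<close>

lemma card_distinct_nodes_le:
  fixes lam alp :: "nat \<Rightarrow> complex"
  shows "\<exists>N0. \<forall>N\<ge>N0. card (lam ` {n \<in> {1..N}. alp n \<noteq> 0}) + (A_S alp + B_S lam alp) \<le> N"
proof -
  define K0 where "K0 = {k \<in> I_S lam alp. 2 \<le> mult_S lam alp k}"
  \<comment> \<open>In HOL, \<open>card\<close> and sums over infinite sets are 0. Replacing an
    infinite \<open>K0\<close> or \<open>Z0\<close> by the empty set therefore keeps the values of
    \<open>B_S\<close> and \<open>A_S\<close> and makes the discarded set finite.\<close>
  define K where "K = (if finite K0 then K0 else {})"
  define Z0 where "Z0 = {n. 1 \<le> n \<and> alp n = 0}"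
  define Z where "Z = (if finite Z0 then Z0 else {})"
  define W where "W k = {n. 1 \<le> n \<and> lam n = lam k \<and> alp n \<noteq> 0}" for k
  define U where "U = (\<Union>k\<in>K. W k - {k})"
  have K: "finite K" "K \<subseteq> K0" and Z: "finite Z" "Z \<subseteq> Z0"
    by (auto simp: K_def Z_def)
  \<comment> \<open>A multiplicity of at least 2 excludes an infinite \<open>W k\<close>, whose
    \<open>card\<close> would be 0.\<close>
  have finW: "finite (W k)" if "k \<in> K" for k
    using that K by (intro card_ge_0_finite) (auto simp: K0_def mult_S_def W_def)
  have inj: "k = k'" if "k \<in> K" "k' \<in> K" "lam k = lam k'" for k k'
  proof -
    have first: "lam n \<noteq> lam m" if "m \<in> I_S lam alp" "n \<in> I_S lam alp" "m < n" for m n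
      using that by (auto simp: I_S_def)
    have "k \<in> I_S lam alp" "k' \<in> I_S lam alp"
      using that K by (auto simp: K0_def)
    with first that(3) have "\<not> k < k'" "\<not> k' < k"
      by metis+
    then show ?thesis by simp
  qed
  have memW: "k \<in> W k" if "k \<in> K" for k
    using that K by (auto simp: K0_def I_S_def W_def)
  have finU: "finite U"
    using K finW by (auto simp: U_def)
  have cardU: "card U = B_S lam alp"
  proof -
    have "card U = (\<Sum>k\<in>K. card (W k - {k}))"
      unfolding U_def using K finW inj
      by (intro card_UN_disjoint) (auto simp: W_def)
    also have "\<dots> = (\<Sum>k\<in>K. mult_S lam alp k - 1)"
      using memW finW by (intro sum.cong) (auto simp: mult_S_def W_def)
    also have "\<dots> = B_S lam alp"
      by (auto simp: K_def B_S_def K0_def)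
    finally show ?thesis .
  qed
  have cardZ: "card Z = A_S alp"
    by (auto simp: Z_def Z0_def A_S_def)
  have "finite (Z \<union> U \<union> K)"
    using Z finU K by auto
  then obtain N0 where N0: "\<And>n. n \<in> Z \<union> U \<union> K \<Longrightarrow> n \<le> N0"
    by (meson finite_nat_set_iff_bounded_le)
  have "card (lam ` {n \<in> {1..N}. alp n \<noteq> 0}) + (A_S alp + B_S lam alp) \<le> N" if "N \<ge> N0" for N
  proof -
    define Y where "Y = {n \<in> {1..N}. alp n \<noteq> 0}"
    define X where "X = Y - U"
    \<comment> \<open>A discarded repetition in \<open>W k\<close> has the same node as
      \<open>k\<close>, and \<open>k\<close> itself is never discarded because distinct elements of
      \<open>K\<close> have distinct nodes.\<close>
    have "lam ` Y \<subseteq> lam ` X"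
    proof
      fix v assume "v \<in> lam ` Y"
      then obtain n where n: "n \<in> Y" "v = lam n" by blast
      show "v \<in> lam ` X"
      proof (cases "n \<in> U")
        case True
        then obtain k where k: "k \<in> K" "n \<in> W k" by (auto simp: U_def)
        have "k \<notin> U"
          using k(1) inj by (auto simp: U_def W_def)
        moreover have "k \<in> Y"
          using memW[OF k(1)] N0[of k] k(1) that by (auto simp: Y_def W_def)
        ultimately show ?thesis
          using k n by (auto simp: X_def W_def)
      qed (use n in \<open>auto simp: X_def\<close>)
    qed
    moreover have "finite X"
      by (simp add: X_def Y_def)
    ultimately have "card (lam ` Y) \<le> card X"
      by (meson card_image_le card_mono finite_imageI le_trans)
    moreover have "card (X \<union> (Z \<union> U)) = card X + (card Z + card U)"
    proof -
      have "Z \<inter> U = {}" "X \<inter> (Z \<union> U) = {}"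
        using Z by (auto simp: Z0_def U_def W_def X_def Y_def)
      moreover have "finite X" by (simp add: X_def Y_def)
      ultimately show ?thesis
        using Z finU by (simp add: card_Un_disjoint)
    qed
    moreover have "X \<union> (Z \<union> U) \<subseteq> {1..N}"
      using N0 that Z by (force simp: X_def Y_def U_def W_def Z0_def)
    then have "card (X \<union> (Z \<union> U)) \<le> N"
      using card_mono[of "{1..N}"] by fastforce
    ultimately show ?thesis
      using cardU cardZ by (simp add: Y_def)
  qed
  then show ?thesis by blast
qed

subsection \<open>Cosine coefficients\<close>

text \<open>The reciprocal of the squared norm of \<open>cos (l t)\<close> in L2 of [0, pi]. These
  are also the values of \<open>alpha_t\<close>, with the zeros at indices 2 to p + 1 left
  out.\<close>

definition cosine_weight :: "nat \<Rightarrow> real" where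
  "cosine_weight l = (if l = 0 then 1 / pi else 2 / pi)"

text \<open>Left unnormalised, so that for \<open>h t = cos (z t)\<close> it is exactly the entry
  \<open>Dt\<close> of the operator; the weight is written out in every sum.\<close>

definition cosine_coeff :: "(real \<Rightarrow> complex) \<Rightarrow> nat \<Rightarrow> complex" where
  "cosine_coeff h l = integral {0..pi} (\<lambda>t. h t * cos (of_nat l * of_real t))"

lemma cosine_weight_pos: "cosine_weight l > 0"
  by (simp add: cosine_weight_def)

lemma cosine_weight_bounds: "1 / pi \<le> cosine_weight l" "cosine_weight l \<le> 1"
  using pi_ge_two by (auto simp: cosine_weight_def field_simps)

lemma has_integral_cos_of_int:
  fixes n :: int
  shows "((\<lambda>t. cos (of_int n * complex_of_real t)) has_integral (if n = 0 then of_real pi else 0)) {0..pi}"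
proof (cases "n = 0")
  case True
  then show ?thesis
    using has_integral_const_real[of "1::complex" 0 pi] by (simp add: scaleR_conv_of_real)
next
  case False
  have sin0: "sin (of_int n * complex_of_real pi) = 0"
    by (metis of_real_0 of_real_mult of_real_of_int_eq sin_npi_int sin_of_real mult.commute)
  have "((\<lambda>t. cos (of_int n * complex_of_real t)) has_integral
     (sin (of_int n * complex_of_real pi) / of_int n - sin (of_int n * complex_of_real 0) / of_int n)) {0..pi}"
  proof (rule fundamental_theorem_of_calculus)
    fix t :: real
    assume "t \<in> {0..pi}"
    have "((\<lambda>z. sin (of_int n * z) / of_int n) has_field_derivative cos (of_int n * complex_of_real t))
            (at (complex_of_real t))"
      using False by (auto intro!: derivative_eq_intros)
    then show "((\<lambda>t. sin (of_int n * complex_of_real t) / of_int n) has_vector_derivative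
          cos (of_int n * complex_of_real t)) (at t within {0..pi})"
      by (rule has_vector_derivative_real_field)
  qed simp
  with False sin0 show ?thesis by simp
qed

text \<open>After the product-to-sum formula only a zero frequency contributes. For l = m = 0 both
  frequencies vanish, which is why the weight at 0 is half the others.\<close>

lemma cos_orthogonal:
  "of_real (cosine_weight l) * integral {0..pi} (\<lambda>t. cos (of_nat m * complex_of_real t) * cos (of_nat l * complex_of_real t))
     = (if l = m then 1 else 0)"
proof -
  have "((\<lambda>t. (cos (of_int (int m - int l) * complex_of_real t) +
               cos (of_int (int m + int l) * complex_of_real t)) / 2)
     has_integral ((if int m - int l = 0 then of_real pi else 0) +
                   (if int m + int l = 0 then of_real pi else 0)) / 2) {0..pi}"
    by (intro has_integral_divide has_integral_add has_integral_cos_of_int)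
  also have "(\<lambda>t. (cos (of_int (int m - int l) * complex_of_real t) +
               cos (of_int (int m + int l) * complex_of_real t)) / 2)
       = (\<lambda>t. cos (of_nat m * complex_of_real t) * cos (of_nat l * complex_of_real t))"
    by (rule ext, subst cos_times_cos) (simp add: ring_distribs)
  finally have "integral {0..pi} (\<lambda>t. cos (of_nat m * complex_of_real t) * cos (of_nat l * complex_of_real t))
      = ((if int m - int l = 0 then of_real pi else 0) + (if int m + int l = 0 then of_real pi else 0)) / 2"
    by (rule integral_unique)
  then show ?thesis
    by (simp only: cosine_weight_def) auto
qed

lemma cosine_coeff_cos_of_nat:
  "of_real (cosine_weight l) * cosine_coeff (\<lambda>t. cos (of_nat m * of_real t)) l = (if l = m then 1 else 0)"
  using cos_orthogonal[of l m] by (simp add: cosine_coeff_def)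

lemma cnj_cos_of_nat:
  "cnj (cos (of_nat l * complex_of_real t)) = cos (of_nat l * complex_of_real t)"
  by (metis cos_of_real complex_cnj_complex_of_real of_real_mult of_real_of_nat_eq)

text \<open>Bessel's inequality: with the partial cosine sum \<open>s\<close> of \<open>h\<close>,
  both the inner product of \<open>h\<close> with \<open>s\<close> and that of \<open>s\<close> with
  itself equal \<open>B\<close>, and the integral of the squared modulus of \<open>h - s\<close> is
  nonnegative.\<close>

lemma bessel_cosine_coeff:
  assumes "continuous_on {0..pi} h"
  shows "(\<Sum>l\<le>L. cosine_weight l * (cmod (cosine_coeff h l))\<^sup>2) \<le> integral {0..pi} (\<lambda>t. (cmod (h t))\<^sup>2)"
proof -
  note [continuous_intros] = assms
  define e where "e l t = cos (of_nat l * complex_of_real t)" for l t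
  define c where "c l = of_real (cosine_weight l) * cosine_coeff h l" for l
  define s where "s t = (\<Sum>l\<le>L. c l * e l t)" for t
  define B where "B = (\<Sum>l\<le>L. cosine_weight l * (cmod (cosine_coeff h l))\<^sup>2)"
  have [continuous_intros]: "continuous_on {0..pi} (e l)" for l
    unfolding e_def by (intro continuous_intros)
  have [continuous_intros]: "continuous_on {0..pi} s"
    unfolding s_def by (intro continuous_intros)
  have cnj_e: "cnj (e l t) = e l t" for l t
    by (simp add: e_def cnj_cos_of_nat)
  have cB: "(\<Sum>l\<le>L. cnj (c l) * cosine_coeff h l) = of_real B"
    by (simp add: c_def B_def complex_norm_square mult_ac del: of_real_power)
  have hs: "((\<lambda>t. h t * cnj (s t)) has_integral of_real B) {0..pi}"
  proof -
    have "((\<lambda>t. \<Sum>l\<le>L. cnj (c l) * (h t * e l t)) has_integral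
            (\<Sum>l\<le>L. cnj (c l) * cosine_coeff h l)) {0..pi}"
      unfolding cosine_coeff_def e_def[symmetric]
      by (intro has_integral_sum has_integral_mult_right integrable_integral integrable_continuous_real
            continuous_intros) auto
    moreover note cB
    moreover have "(\<lambda>t. \<Sum>l\<le>L. cnj (c l) * (h t * e l t)) = (\<lambda>t. h t * cnj (s t))"
      by (simp add: s_def cnj_e sum_distrib_left mult_ac)
    ultimately show ?thesis by simp
  qed
  have ss: "((\<lambda>t. s t * cnj (s t)) has_integral of_real B) {0..pi}"
  proof -
    have se: "((\<lambda>t. s t * e l t) has_integral cosine_coeff h l) {0..pi}" if "l \<le> L" for l
    proof -
      have "((\<lambda>t. \<Sum>m\<le>L. c m * (e m t * e l t)) has_integral
            (\<Sum>m\<le>L. c m * integral {0..pi} (\<lambda>t. e m t * e l t))) {0..pi}"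
        by (intro has_integral_sum has_integral_mult_right integrable_integral integrable_continuous_real
            continuous_intros) auto
      moreover have "(\<Sum>m\<le>L. c m * integral {0..pi} (\<lambda>t. e m t * e l t)) = cosine_coeff h l"
      proof -
        have "c m * integral {0..pi} (\<lambda>t. e m t * e l t) = (if m = l then cosine_coeff h l else 0)" for m
        proof -
          have "of_real (cosine_weight m) * integral {0..pi} (\<lambda>t. e m t * e l t) = (if m = l then 1 else 0)"
            using cos_orthogonal[of m l] by (simp add: e_def mult.commute)
          then have "cosine_coeff h m * (of_real (cosine_weight m) * integral {0..pi} (\<lambda>t. e m t * e l t))
                      = cosine_coeff h m * (if m = l then 1 else 0)"
            by (rule arg_cong)
          then show ?thesis
            by (auto simp: c_def mult_ac split: if_splits)
        qed
        then show ?thesis using that by simp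
      qed
      moreover have "(\<lambda>t. \<Sum>m\<le>L. c m * (e m t * e l t)) = (\<lambda>t. s t * e l t)"
        by (simp add: s_def sum_distrib_left sum_distrib_right mult_ac)
      ultimately show ?thesis by simp
    qed
    have "((\<lambda>t. \<Sum>l\<le>L. cnj (c l) * (s t * e l t)) has_integral
            (\<Sum>l\<le>L. cnj (c l) * cosine_coeff h l)) {0..pi}"
      by (intro has_integral_sum has_integral_mult_right se) auto
    moreover note cB
    moreover have "(\<lambda>t. \<Sum>l\<le>L. cnj (c l) * (s t * e l t)) = (\<lambda>t. s t * cnj (s t))"
      by (rule ext, subst (2) s_def) (simp add: cnj_e sum_distrib_left mult_ac)
    ultimately show ?thesis by simp
  qed
  have hh: "((\<lambda>t. (cmod (h t))\<^sup>2) has_integral integral {0..pi} (\<lambda>t. (cmod (h t))\<^sup>2)) {0..pi}"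
    by (intro integrable_integral integrable_continuous_real continuous_intros)
  have "((\<lambda>t. (cmod (h t))\<^sup>2 - 2 * Re (h t * cnj (s t)) + Re (s t * cnj (s t))) has_integral
          (integral {0..pi} (\<lambda>t. (cmod (h t))\<^sup>2) - 2 * B + B)) {0..pi}"
    using has_integral_linear[OF hs bounded_linear_Re] has_integral_linear[OF ss bounded_linear_Re]
    by (intro has_integral_add has_integral_diff has_integral_mult_right hh) (simp_all add: o_def)
  moreover have "0 \<le> (cmod (h t))\<^sup>2 - 2 * Re (h t * cnj (s t)) + Re (s t * cnj (s t))" for t
  proof -
    have "(cmod (h t))\<^sup>2 - 2 * Re (h t * cnj (s t)) + Re (s t * cnj (s t)) = (cmod (h t - s t))\<^sup>2"
      unfolding cmod_power2 by (simp add: power2_eq_square algebra_simps)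
    then show ?thesis by simp
  qed
  ultimately have "0 \<le> integral {0..pi} (\<lambda>t. (cmod (h t))\<^sup>2) - 2 * B + B"
    by (rule has_integral_nonneg)
  then show ?thesis by (simp add: B_def)
qed

lemma bessel_cosine_coeff_bounded:
  assumes "continuous_on {0..pi} h" "\<And>t. t \<in> {0..pi} \<Longrightarrow> cmod (h t) \<le> C"
  shows "(\<Sum>l<L. cosine_weight l * (cmod (cosine_coeff h l))\<^sup>2) \<le> pi * C\<^sup>2"
proof -
  have "(\<Sum>l<L. cosine_weight l * (cmod (cosine_coeff h l))\<^sup>2)
         \<le> (\<Sum>l\<le>L. cosine_weight l * (cmod (cosine_coeff h l))\<^sup>2)"
    by (intro sum_mono2) (auto intro!: mult_nonneg_nonneg simp: less_imp_le[OF cosine_weight_pos])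
  also have "\<dots> \<le> integral {0..pi} (\<lambda>t. (cmod (h t))\<^sup>2)"
    by (rule bessel_cosine_coeff[OF assms(1)])
  also have "\<dots> \<le> integral {0..pi} (\<lambda>t. C\<^sup>2)"
    using assms by (intro integral_le integrable_continuous_real continuous_intros power_mono) auto
  finally show ?thesis by simp
qed

lemma summable_cosine_coeff_square:
  assumes "continuous_on {0..pi} h"
  shows "summable (\<lambda>l. cosine_weight l * (cmod (cosine_coeff h l))\<^sup>2)"
proof -
  have "compact (h ` {0..pi})"
    by (intro compact_continuous_image assms) simp
  then obtain C where "\<And>t. t \<in> {0..pi} \<Longrightarrow> cmod (h t) \<le> C"
    by (meson compact_imp_bounded bounded_iff image_eqI)
  then have "(\<Sum>l<L. cosine_weight l * (cmod (cosine_coeff h l))\<^sup>2) \<le> pi * C\<^sup>2" for L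
    by (rule bessel_cosine_coeff_bounded[OF assms])
  then show ?thesis
    by (intro summableI_nonneg_bounded) (auto simp: less_imp_le[OF cosine_weight_pos])
qed

section \<open>Complex cosines in a horizontal strip, and weighted pairings of sequences\<close>

lemma norm_sin_le_exp_abs_Im: "cmod (sin z) \<le> exp \<bar>Im z\<bar>"
proof -
  have "cmod (sin z) = cmod (exp (\<i> * z) - exp (- (\<i> * z))) / 2"
    by (simp add: sin_exp_eq norm_divide norm_mult)
  also have "\<dots> \<le> (exp (- Im z) + exp (Im z)) / 2"
    using norm_triangle_ineq4[of "exp (\<i> * z)" "exp (- (\<i> * z))"] by (simp add: norm_exp_eq_Re)
  also have "\<dots> \<le> exp \<bar>Im z\<bar>"
  proof -
    have "exp (- Im z) + exp (Im z) \<le> exp \<bar>Im z\<bar> + exp \<bar>Im z\<bar>"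
      by (intro add_mono) simp_all
    then show ?thesis by simp
  qed
  finally show ?thesis .
qed

lemma norm_t_sin_le:
  assumes "t \<in> {0..pi}" "\<bar>Im z\<bar> \<le> Y"
  shows "cmod (complex_of_real t * sin (z * of_real t)) \<le> pi * exp (pi * Y)"
proof -
  have "\<bar>Im (z * of_real t)\<bar> \<le> pi * Y"
    using assms mult_mono[of "\<bar>Im z\<bar>" Y t pi] by (simp add: abs_mult mult.commute)
  then have "cmod (sin (z * of_real t)) \<le> exp (pi * Y)"
    by (intro order.trans[OF norm_sin_le_exp_abs_Im]) simp
  then show ?thesis
    using assms by (auto simp: norm_mult intro!: mult_mono)
qed

text \<open>The strip is convex and the derivative in \<open>z\<close> is bounded there
  independently of the real part, so one Lipschitz constant serves all nodes.\<close>

lemma norm_cos_diff_le: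
  assumes "t \<in> {0..pi}" "\<bar>Im z\<bar> \<le> Y" "\<bar>Im w\<bar> \<le> Y"
  shows "cmod (cos (z * of_real t) - cos (w * of_real t)) \<le> pi * exp (pi * Y) * cmod (z - w)"
proof -
  let ?S = "{z. - Y \<le> Im z} \<inter> {z. Im z \<le> Y}"
  have "convex ?S"
    by (intro convex_Int convex_halfspace_Im_le convex_halfspace_Im_ge)
  then show ?thesis
  proof (rule field_differentiable_bound[where f' = "\<lambda>z. - (of_real t * sin (z * of_real t))"])
    show "((\<lambda>z. cos (z * of_real t)) has_field_derivative - (of_real t * sin (z * of_real t))) (at z within ?S)" for z
      by (auto intro!: derivative_eq_intros)
    show "cmod (- (of_real t * sin (z * of_real t))) \<le> pi * exp (pi * Y)" if "z \<in> ?S" for z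
      using norm_t_sin_le[OF assms(1), of z Y] that by auto
  qed (use assms in auto)
qed

lemma norm_weighted_product_le:
  fixes u v :: "nat \<Rightarrow> complex"
  shows "cmod (of_real (cosine_weight l) * u l * v l)
           \<le> (cosine_weight l * (cmod (u l))\<^sup>2 + cosine_weight l * (cmod (v l))\<^sup>2) / 2"
proof -
  have "cosine_weight l * (2 * cmod (u l) * cmod (v l)) \<le> cosine_weight l * ((cmod (u l))\<^sup>2 + (cmod (v l))\<^sup>2)"
    by (intro mult_left_mono sum_squares_bound) (simp add: less_imp_le[OF cosine_weight_pos])
  then show ?thesis
    using cosine_weight_pos[of l] by (simp add: norm_mult algebra_simps)
qed

lemma cosine_coeff_diff_quotient:
  "cosine_coeff (\<lambda>t. (cos (z * of_real t) - cos (w * of_real t)) / d) l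
     = (cosine_coeff (\<lambda>t. cos (z * of_real t)) l - cosine_coeff (\<lambda>t. cos (w * of_real t)) l) / d"
proof -
  have "cosine_coeff (\<lambda>t. (cos (z * of_real t) - cos (w * of_real t)) / d) l
     = integral {0..pi} (\<lambda>t. (cos (z * of_real t) * cos (of_nat l * of_real t)
                               - cos (w * of_real t) * cos (of_nat l * of_real t)) / d)"
    by (simp add: cosine_coeff_def algebra_simps)
  also have "\<dots> = integral {0..pi} (\<lambda>t. cos (z * of_real t) * cos (of_nat l * of_real t)
                               - cos (w * of_real t) * cos (of_nat l * of_real t)) / d"
    by (rule integral_divide)
  also have "\<dots> = (cosine_coeff (\<lambda>t. cos (z * of_real t)) l - cosine_coeff (\<lambda>t. cos (w * of_real t)) l) / d"
    unfolding cosine_coeff_def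
    by (subst integral_diff) (auto intro!: integrable_continuous_real continuous_intros)
  finally show ?thesis .
qed

lemma norm_cos_diff_quotient_le:
  assumes "t \<in> {0..pi}" "\<bar>Im z\<bar> \<le> Y" "\<bar>Im w\<bar> \<le> Y"
  shows "cmod ((cos (z * of_real t) - cos (w * of_real t)) / (z - w)) \<le> pi * exp (pi * Y)"
\<comment> \<open>For \<open>z = w\<close> the quotient is 0, the value of division by 0.\<close>
proof (cases "z = w")
  case False
  then show ?thesis
    using norm_cos_diff_le[OF assms] by (simp add: norm_divide divide_le_eq)
qed simp

text \<open>Dominated convergence for series; the inequality between arithmetic and geometric means
  turns the two square summable bounds into the summable majorant \<open>B\<close>.\<close>

lemma tannery_weighted:
  fixes X :: "nat \<Rightarrow> nat \<Rightarrow> complex"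
  assumes lim: "\<And>l. (\<lambda>n. X n l) \<longlonglongrightarrow> f l"
    and bound: "\<And>n l. cmod (X n l) \<le> g l"
    and u: "summable (\<lambda>l. cosine_weight l * (cmod (u l))\<^sup>2)"
    and g: "summable (\<lambda>l. (g l)\<^sup>2)"
  shows "(\<lambda>n. \<Sum>l. of_real (cosine_weight l) * u l * X n l) \<longlonglongrightarrow> (\<Sum>l. of_real (cosine_weight l) * u l * f l)"
proof -
  have g0: "0 \<le> g l" for l
    using bound[of 0 l] norm_ge_zero order.trans by blast
  define B where "B l = (cosine_weight l * (cmod (u l))\<^sup>2 + (g l)\<^sup>2) / 2" for l
  have "summable B"
    unfolding B_def by (intro summable_divide summable_add u g)
  have "cmod (of_real (cosine_weight l) * u l * X n l) \<le> B l" for n l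
  proof -
    have "cosine_weight l * (cmod (X n l))\<^sup>2 \<le> 1 * (g l)\<^sup>2"
      using cosine_weight_bounds[of l] cosine_weight_pos[of l] bound[of n l]
      by (intro mult_mono power_mono) auto
    then show ?thesis
      using norm_weighted_product_le[of l u "X n"] by (simp add: B_def)
  qed
  then have "eventually (\<lambda>(l, n). cmod (of_real (cosine_weight l) * u l * X n l) \<le> B l) (at_top \<times>\<^sub>F sequentially)"
    by (intro always_eventually) auto
  then show ?thesis
    by (intro tannerys_theorem[where M = B, THEN conjunct2, THEN conjunct2] tendsto_intros lim
          \<open>summable B\<close>) auto
qed

subsection \<open>Incompleteness of the perturbed cosine system\<close>

text \<open>The exceptional set \<open>R\<close> takes the place of the conditions with m from 1 to
  \<open>M\<close>; from there on \<open>nu m\<close> is the node near \<open>m\<close>. The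
  sequence \<open>f\<close> lists cosine coefficients, so each sum is the pairing of a function with
  \<open>cos (z t)\<close>.\<close>

lemma exists_sequence_orthogonal_to_cosines:
  fixes nu :: "nat \<Rightarrow> complex" and R :: "complex set"
  assumes R: "finite R" "card R \<le> M"
    and Im: "\<And>m. \<bar>Im (nu m)\<bar> \<le> Y"
    and l2: "summable (\<lambda>m. (cmod (nu m - of_nat m))\<^sup>2)"
  shows "\<exists>f. summable (\<lambda>l. (cmod (f l))\<^sup>2) \<and> (\<exists>l. f l \<noteq> 0) \<and>
           (\<forall>z\<in>R \<union> nu ` {M<..}.
              (\<Sum>l. of_real (cosine_weight l) * cosine_coeff (\<lambda>t. cos (z * of_real t)) l * f l) = 0)"
proof -
  define c where "c z l = cosine_coeff (\<lambda>t. cos (z * of_real t)) l" for z l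
  define C where "C = pi * exp (pi * Y)"
  have Y: "0 \<le> Y"
    using Im[of 0] by linarith
  \<comment> \<open>Truncated problem: L + M + 1 unknowns against at most M + L equations, with the
    solution normalised in the weighted norm.\<close>
  have "\<forall>L. \<exists>x. (\<forall>l>L + M. x l = 0) \<and> (\<Sum>l\<le>L + M. cosine_weight l * (cmod (x l))\<^sup>2) = 1 \<and>
            (\<forall>z\<in>R \<union> nu ` {M<..L + M}. (\<Sum>l\<le>L + M. of_real (cosine_weight l) * c z l * x l) = 0)"
    (is "\<forall>L. ?P L")
  proof
    fix L
    have "card (R \<union> nu ` {M<..L + M}) \<le> card R + card (nu ` {M<..L + M})"
      by (rule card_Un_le)
    also have "\<dots> \<le> M + L"
      using R card_image_le[of "{M<..L + M}" nu] by (intro add_mono) auto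
    finally have "card (R \<union> nu ` {M<..L + M}) < card {..L + M}" by simp
    from homogeneous_system_nontrivial_solution[OF _ _ this, of "\<lambda>z l. of_real (cosine_weight l) * c z l"] R
    obtain x where x: "\<exists>l\<le>L + M. x l \<noteq> 0"
      and eq: "\<forall>z\<in>R \<union> nu ` {M<..L + M}. (\<Sum>l\<le>L + M. of_real (cosine_weight l) * c z l * x l) = 0"
      by auto
    define s where "s = (\<Sum>l\<le>L + M. cosine_weight l * (cmod (x l))\<^sup>2)"
    define y where "y l = (if l \<le> L + M then x l / of_real (sqrt s) else 0)" for l
    have "s > 0"
    proof -
      obtain l where "l \<le> L + M" "x l \<noteq> 0" using x by blast
      then show ?thesis
        unfolding s_def using cosine_weight_pos
        by (intro sum_pos2[of _ l]) (auto intro!: mult_nonneg_nonneg simp: less_imp_le)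
    qed
    then have "(\<Sum>l\<le>L + M. cosine_weight l * (cmod (y l))\<^sup>2) = (\<Sum>l\<le>L + M. cosine_weight l * (cmod (x l))\<^sup>2 / s)"
      by (intro sum.cong) (auto simp: y_def norm_divide power_divide)
    also have "\<dots> = 1"
      using \<open>s > 0\<close> by (simp add: sum_divide_distrib[symmetric] s_def[symmetric])
    finally have "(\<Sum>l\<le>L + M. cosine_weight l * (cmod (y l))\<^sup>2) = 1" .
    moreover have "(\<Sum>l\<le>L + M. of_real (cosine_weight l) * c z l * y l) = 0" if "z \<in> R \<union> nu ` {M<..L + M}" for z
    proof -
      have "(\<Sum>l\<le>L + M. of_real (cosine_weight l) * c z l * y l)
           = (\<Sum>l\<le>L + M. of_real (cosine_weight l) * c z l * x l / of_real (sqrt s))"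
        by (intro sum.cong) (auto simp: y_def)
      also have "\<dots> = 0"
        using eq that by (simp add: sum_divide_distrib[symmetric])
      finally show ?thesis .
    qed
    ultimately show "?P L"
      by (intro exI[of _ y]) (auto simp: y_def)
  qed
  from choice[OF this] obtain X where supp: "\<And>L l. l > L + M \<Longrightarrow> X L l = 0"
    and normed: "\<And>L. (\<Sum>l\<le>L + M. cosine_weight l * (cmod (X L l))\<^sup>2) = 1"
    and eq: "\<And>L z. z \<in> R \<union> nu ` {M<..L + M} \<Longrightarrow> (\<Sum>l\<le>L + M. of_real (cosine_weight l) * c z l * X L l) = 0"
    by blast
  have bound2: "cmod (X L l) \<le> 2" for L l
  proof (cases "l \<le> L + M")
    case True
    have "1 / pi * (cmod (X L l))\<^sup>2 \<le> cosine_weight l * (cmod (X L l))\<^sup>2"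
      by (intro mult_right_mono cosine_weight_bounds) auto
    also have "\<dots> \<le> 1"
      unfolding normed[of L, symmetric] using True less_imp_le[OF cosine_weight_pos]
      by (intro member_le_sum) auto
    finally have "(cmod (X L l))\<^sup>2 \<le> pi" by (simp add: field_simps)
    also have "\<dots> \<le> 2\<^sup>2" using pi_less_4 by simp
    finally show ?thesis by (rule power2_le_imp_le) simp
  qed (simp add: supp)
  \<comment> \<open>The bound for the pairing \<open>S\<close> below: Bessel gives
    \<open>pi * C^2\<close> for the difference quotient, the normalisation gives 1, and the mean
    inequality halves their sum.\<close>
  define K where "K = (pi * C\<^sup>2 + 1) / 2"
  have K: "K \<ge> 0" by (simp add: K_def)
  \<comment> \<open>Key estimate, uniform in \<open>L\<close>: the entry at \<open>m\<close> is the
    pairing with \<open>cos (m t)\<close>, while the pairing with \<open>cos (nu m t)\<close>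
    vanishes. The difference of the two is \<open>nu m - m\<close> times a bounded pairing.\<close>
  have tail: "cmod (X L m) \<le> K * cmod (nu m - of_nat m)" if "M < m" for L m
  proof (cases "m \<le> L + M")
    case True
    \<comment> \<open>If \<open>nu m = m\<close>, then \<open>h\<close> is 0 by the convention for
      division, and \<open>ch\<close> still holds since both sides vanish.\<close>
    define h where "h t = (cos (nu m * of_real t) - cos (of_nat m * of_real t)) / (nu m - of_nat m)" for t
    have h: "continuous_on {0..pi} h"
      unfolding h_def divide_inverse by (intro continuous_intros)
    have hC: "cmod (h t) \<le> C" if "t \<in> {0..pi}" for t
      unfolding h_def C_def using that Im Y by (intro norm_cos_diff_quotient_le) auto
    define S where "S = (\<Sum>l\<le>L + M. of_real (cosine_weight l) * cosine_coeff h l * X L l)"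
    have ch: "(nu m - of_nat m) * cosine_coeff h l = c (nu m) l - c (of_nat m) l" for l
      unfolding h_def cosine_coeff_diff_quotient c_def by (cases "nu m = of_nat m") auto
    have "X L m = (\<Sum>l\<le>L + M. (if l = m then 1 else 0) * X L l)"
      using True by (simp add: if_distrib[of "\<lambda>x. x * _"] cong: if_cong)
    also have "\<dots> = (\<Sum>l\<le>L + M. of_real (cosine_weight l) * c (of_nat m) l * X L l)"
      unfolding c_def cosine_coeff_cos_of_nat ..
    also have "\<dots> = (\<Sum>l\<le>L + M. of_real (cosine_weight l) * c (nu m) l * X L l)
                     - (\<Sum>l\<le>L + M. of_real (cosine_weight l) * ((nu m - of_nat m) * cosine_coeff h l) * X L l)"
      unfolding ch by (simp add: sum_subtractf[symmetric] algebra_simps)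
    also have "\<dots> = - ((nu m - of_nat m) * S)"
      using eq[of "nu m" L] True that by (simp add: S_def sum_distrib_left mult_ac)
    finally have "cmod (X L m) = cmod (nu m - of_nat m) * cmod S"
      by (metis norm_minus_cancel norm_mult)
    moreover have "cmod S \<le> K"
    proof -
      have "cmod S \<le> (\<Sum>l\<le>L + M. (cosine_weight l * (cmod (cosine_coeff h l))\<^sup>2 + cosine_weight l * (cmod (X L l))\<^sup>2) / 2)"
        unfolding S_def by (intro sum_norm_le norm_weighted_product_le)
      also have "\<dots> = ((\<Sum>l\<le>L + M. cosine_weight l * (cmod (cosine_coeff h l))\<^sup>2) + 1) / 2"
        unfolding sum_divide_distrib[symmetric] sum.distrib normed ..
      also have "\<dots> \<le> K"
        using bessel_cosine_coeff_bounded[OF h hC, of "Suc (L + M)"]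
        by (simp add: K_def lessThan_Suc_atMost)
      finally show ?thesis .
    qed
    ultimately show ?thesis
      by (metis mult.commute mult_right_mono norm_ge_zero)
  qed (use K in \<open>simp add: supp\<close>)
  \<comment> \<open>The sides of the Hilbert cube: a crude bound for the first entries,
    \<open>tail\<close> for the others.\<close>
  define g where "g l = (if l \<le> M then 2 else K * cmod (nu l - of_nat l))" for l
  have Xg: "cmod (X L l) \<le> g l" for L l
    using bound2 tail by (auto simp: g_def)
  have g: "summable (\<lambda>l. (g l)\<^sup>2)"
  proof (rule summable_comparison_test_ev)
    show "summable (\<lambda>l. K\<^sup>2 * (cmod (nu l - of_nat l))\<^sup>2)"
      by (intro summable_mult l2)
    show "\<forall>\<^sub>F l in sequentially. norm ((g l)\<^sup>2) \<le> K\<^sup>2 * (cmod (nu l - of_nat l))\<^sup>2"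
      using eventually_gt_at_top[of M] by eventually_elim (simp add: g_def power_mult_distrib)
  qed
  \<comment> \<open>Diagonal subsequence with entrywise limits; the majorant \<open>g\<close> later
    upgrades this to convergence of norms and pairings.\<close>
  obtain k where k: "strict_mono (k :: nat \<Rightarrow> nat)" and "\<And>l. \<exists>y. (\<lambda>n. X (k n) l) \<longlonglongrightarrow> y"
    using function_convergent_subsequence[of UNIV X 2] bound2 by auto
  then obtain f where f: "\<And>l. (\<lambda>n. X (k n) l) \<longlonglongrightarrow> f l"
    by metis
  have fg: "cmod (f l) \<le> g l" for l
    using f[of l] Xg by (intro LIMSEQ_le_const2[OF tendsto_norm[OF f]]) auto
  have f2: "summable (\<lambda>l. (cmod (f l))\<^sup>2)"
    by (rule summable_comparison_test[OF _ g]) (auto intro!: exI[of _ 0] power_mono fg)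
  have fin: "(\<Sum>l. F l * X L l) = (\<Sum>l\<le>L + M. F l * X L l)" for F L
    by (rule suminf_finite) (auto simp: supp not_le)
  \<comment> \<open>Were the limit zero, dominated convergence would drive the norms to 0, although
    all of them equal 1.\<close>
  have "\<exists>l. f l \<noteq> 0"
  proof (rule ccontr)
    assume "\<nexists>l. f l \<noteq> 0"
    then have f0: "(\<lambda>n. X (k n) l) \<longlonglongrightarrow> 0" for l
      using f[of l] by simp
    have "(\<lambda>n. \<Sum>l. cosine_weight l * (cmod (X (k n) l))\<^sup>2) \<longlonglongrightarrow> (\<Sum>l. 0)"
    proof (rule tannerys_theorem[where M = "\<lambda>l. (g l)\<^sup>2", THEN conjunct2, THEN conjunct2])
      show "(\<lambda>n. cosine_weight l * (cmod (X (k n) l))\<^sup>2) \<longlonglongrightarrow> 0" for l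
        by (rule tendsto_eq_intros tendsto_norm f0 refl | simp)+
      have "cosine_weight l * (cmod (X (k n) l))\<^sup>2 \<le> 1 * (g l)\<^sup>2" for n l
        using cosine_weight_bounds[of l] cosine_weight_pos[of l]
        by (intro mult_mono power_mono Xg) auto
      then show "\<forall>\<^sub>F (l, n) in sequentially \<times>\<^sub>F sequentially. norm (cosine_weight l * (cmod (X (k n) l))\<^sup>2) \<le> (g l)\<^sup>2"
        using cosine_weight_pos by (intro always_eventually) (auto simp: less_imp_le)
    qed (use g in auto)
    moreover have "(\<Sum>l. cosine_weight l * (cmod (X L l))\<^sup>2) = 1" for L
      unfolding normed[of L, symmetric] by (rule suminf_finite) (auto simp: supp not_le)
    ultimately show False
      by (simp add: LIMSEQ_const_iff)
  qed
  moreover have "(\<Sum>l. of_real (cosine_weight l) * c z l * f l) = 0" if z: "z \<in> R \<union> nu ` {M<..}" for z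
  proof -
    have "continuous_on {0..pi} (\<lambda>t. cos (z * complex_of_real t))"
      by (intro continuous_intros)
    then have "(\<lambda>n. \<Sum>l. of_real (cosine_weight l) * c z l * X (k n) l) \<longlonglongrightarrow> (\<Sum>l. of_real (cosine_weight l) * c z l * f l)"
      unfolding c_def by (intro tannery_weighted[OF f Xg] summable_cosine_coeff_square g)
    moreover have "\<forall>\<^sub>F n in sequentially. (\<Sum>l. of_real (cosine_weight l) * c z l * X (k n) l) = 0"
    proof -
      \<comment> \<open>A fixed condition \<open>z\<close> belongs to all sufficiently large
        truncated systems, so its pairing is eventually exactly 0 along the subsequence.\<close>
      obtain n0 where n0: "\<And>n. n \<ge> n0 \<Longrightarrow> z \<in> R \<union> nu ` {M<..n + M}"
      proof (cases "z \<in> R")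
        case False
        then obtain m where "z = nu m" "M < m" using z by auto
        then show ?thesis by (intro that[of m]) auto
      qed (use that in blast)
      show ?thesis
        using eventually_ge_at_top[of n0]
      proof eventually_elim
        case (elim n)
        then have "n0 \<le> k n" using seq_suble[OF k, of n] by linarith
        then show ?case unfolding fin by (intro eq n0)
      qed
    qed
    then have "(\<lambda>n. \<Sum>l. of_real (cosine_weight l) * c z l * X (k n) l) \<longlonglongrightarrow> 0"
      by (rule tendsto_eventually)
    ultimately show ?thesis
      by (rule LIMSEQ_unique)
  qed
  ultimately show ?thesis
    using f2 unfolding c_def by blast
qed

subsection \<open>The null vector\<close>

lemma norm_le_sqrt_suminf:
  assumes "summable (\<lambda>n. (norm (u n))\<^sup>2)"
  shows "norm (u n) \<le> sqrt (\<Sum>n. (norm (u n))\<^sup>2)"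
  using sum_le_suminf[OF assms, of "{n}"] by (simp add: real_le_rsqrt)

section \<open>Model nodes and blocks of the operator in terms of cosine coefficients\<close>

lemma rho_t_eq: "rho_t p n = of_nat (n - p - 1)"
  by (simp add: rho_t_def)

text \<open>The cosine is even, so the sign picked by \<open>csqrt\<close> does not matter.\<close>

lemma cos_csqrt_square: "cos (csqrt (z\<^sup>2) * w) = cos (z * w)"
proof -
  have "csqrt (z\<^sup>2) = z \<or> csqrt (z\<^sup>2) = - z"
    by (metis power2_csqrt power2_eq_iff)
  then show ?thesis by auto
qed

lemma Dt_square: "Dt pi (z\<^sup>2) ((of_nat l)\<^sup>2) = cosine_coeff (\<lambda>t. cos (z * of_real t)) l"
  by (simp only: Dt_def cos_csqrt_square cosine_coeff_def)

text \<open>In the variable \<open>r\<close> the integrand is the entire function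
  \<open>cos (r t)\<close> times a fixed factor, so differentiation under the integral applies with
  no trouble from the branch cut of \<open>csqrt\<close>.\<close>

lemma deriv_Dt_square:
  "deriv (\<lambda>r. a * Dt pi (r\<^sup>2) ((of_nat l)\<^sup>2)) z
     = a * cosine_coeff (\<lambda>t. - (of_real t * sin (z * of_real t))) l"
proof -
  have "((\<lambda>r. integral (cbox 0 pi) (\<lambda>t. cos (r * of_real t) * cos (of_nat l * of_real t))) has_field_derivative
        integral (cbox 0 pi) (\<lambda>t. - (of_real t * sin (z * of_real t)) * cos (of_nat l * complex_of_real t)))
        (at z within UNIV)"
  proof (rule leibniz_rule_field_derivative)
    show "((\<lambda>r. cos (r * complex_of_real t) * cos (of_nat l * of_real t)) has_field_derivative
        - (of_real t * sin (r * of_real t)) * cos (of_nat l * of_real t)) (at r within UNIV)" for r t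
      by (auto intro!: derivative_eq_intros)
    show "continuous_on (UNIV \<times> cbox 0 pi)
       (\<lambda>(r, t). - (complex_of_real t * sin (r * of_real t)) * cos (of_nat l * of_real t))"
      unfolding split_beta by (intro continuous_intros)
    show "(\<lambda>t. cos (r * complex_of_real t) * cos (of_nat l * of_real t)) integrable_on cbox 0 pi" for r
      by (intro integrable_continuous continuous_intros)
  qed auto
  then have "((\<lambda>r. a * cosine_coeff (\<lambda>t. cos (r * of_real t)) l) has_field_derivative
      a * cosine_coeff (\<lambda>t. - (of_real t * sin (z * of_real t))) l) (at z)"
    unfolding cosine_coeff_def by (intro DERIV_cmult) simp
  then show ?thesis
    unfolding Dt_square by (rule DERIV_imp_deriv)
qed

text \<open>Undoes \<open>Tm\<close>: for the null vector the two combinations on the right are the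
  values of F at the given node and at the model node.\<close>

lemma sum_mmul2_Tinv:
  "(\<Sum>j<2. mmul2 A (Tinv p lam k) i j * v j) = A i 0 * (rho_hat p lam k * v 0 + v 1) + A i 1 * v 1"
  by (simp add: mmul2_def Tinv_def mat2_def numeral_2_eq_2 algebra_simps)

text \<open>The model weights are the cosine weights shifted by p + 1. Of the first p + 1 terms only
  the one with index 1 is nonzero; it carries weight \<open>1 / pi\<close> and, by truncated
  subtraction, argument 0.\<close>

lemma sums_alpha_t:
  assumes "summable (\<lambda>l. of_real (cosine_weight l) * y l)"
  shows "(\<lambda>k. alpha_t p (Suc k) * y (Suc k - p - 1)) sums (\<Sum>l. of_real (cosine_weight l) * y l)"
proof -
  define S where "S = (\<Sum>l. of_real (cosine_weight l) * y l)"
  define g where "g k = alpha_t p (Suc k) * y (Suc k - p - 1)" for k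
  have "(\<lambda>l. of_real (cosine_weight l) * y l) sums S"
    unfolding S_def using assms by (rule summable_sums)
  then have "(\<lambda>l. of_real (cosine_weight (Suc l)) * y (Suc l)) sums (S - of_real (cosine_weight 0) * y 0)"
    by (subst sums_Suc_iff) simp
  moreover have "g (k + (p + 1)) = of_real (cosine_weight (Suc k)) * y (Suc k)" for k
  proof -
    have "Suc (k + (p + 1)) - p - 1 = Suc k" by simp
    then show ?thesis by (simp add: g_def alpha_t_def cosine_weight_def)
  qed
  moreover have "sum g {..<p + 1} = of_real (cosine_weight 0) * y 0"
  proof -
    have "sum g {..<p + 1} = (\<Sum>k<p + 1. if k = 0 then of_real (cosine_weight 0) * y 0 else 0)"
      by (intro sum.cong) (auto simp: g_def alpha_t_def cosine_weight_def)
    then show ?thesis by simp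
  qed
  ultimately have "(\<lambda>k. g (k + (p + 1))) sums (S - sum g {..<p + 1})"
    by (simp only:)
  then have "g sums S"
    by (simp only: sums_iff_shift diff_add_cancel)
  then show ?thesis
    by (simp only: g_def[abs_def] S_def)
qed

context
  fixes p :: nat and lam alp :: "nat \<Rightarrow> complex"
begin

text \<open>Integrating \<open>f\<close> against \<open>row_kernel n\<close> gives, for \<open>i = 0\<close>, the divided difference of \<open>F\<close> at
  \<open>\<rho>\<^sub>n\<close> and the model node (the derivative if they coincide), and, for \<open>i = 1\<close>, the value of \<open>F\<close> at
  the model node.\<close>
definition row_kernel :: "nat \<Rightarrow> nat \<Rightarrow> real \<Rightarrow> complex" where
  "row_kernel n i t =
     (if i \<noteq> 0 then cos (rho_t p n * of_real t)
      else if rho_hat p lam n \<noteq> 0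
      then (cos (rho_of (lam n) * of_real t) - cos (rho_t p n * of_real t)) / rho_hat p lam n
      else - (of_real t * sin (rho_of (lam n) * of_real t)))"

lemma continuous_row_kernel: "continuous_on A (row_kernel n i)"
  unfolding row_kernel_def divide_inverse
  by (cases "i = 0"; cases "rho_hat p lam n = 0") (auto intro!: continuous_intros)

lemma norm_row_kernel_le:
  assumes "t \<in> {0..pi}" "\<bar>Im (rho_of (lam n))\<bar> \<le> Y"
  shows "cmod (row_kernel n 0 t) \<le> pi * exp (pi * Y)"
  using norm_cos_diff_quotient_le[OF assms, of "rho_t p n"] norm_t_sin_le[OF assms] assms
  by (auto simp: row_kernel_def rho_hat_def rho_t_eq)

text \<open>The column of the given data drops out: either \<open>alp k = 0\<close> kills its
  entries, or the value at the node is 0. What remains is the model column, which has one form in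
  both branches of \<open>Hblock\<close> thanks to \<open>row_kernel\<close>.\<close>

lemma Hblock_row_sum:
  assumes v: "alp k * (rho_hat p lam k * v 0 + v 1) = 0" and i: "i < 2"
  shows "(\<Sum>j<2. Hblock p lam alp pi n k i j * v j)
           = - (alpha_t p k * (cosine_coeff (row_kernel n i) (k - p - 1) * v 1))"
proof -
  define A where "A = (if rho_hat p lam n \<noteq> 0 then mmul2 (Tm p lam n) (Qmat p lam alp pi n k)
      else mat2
                 (deriv (\<lambda>r. alphaj p alp k 0 * Dt pi (r\<^sup>2) (lamj p lam k 0)) (rhoj p lam n 0))
                 (- deriv (\<lambda>r. alphaj p alp k 1 * Dt pi (r\<^sup>2) (lamj p lam k 1)) (rhoj p lam n 0))
                 (Qt p lam alp pi n 1 k 0) (- Qt p lam alp pi n 1 k 1))"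
  have H: "Hblock p lam alp pi n k = mmul2 A (Tinv p lam k)"
    by (simp add: Hblock_def A_def)
  have i01: "i = 0 \<or> i = 1" using i by auto
  have "A i 0 * (rho_hat p lam k * v 0 + v 1) = 0"
  proof (cases "alp k = 0")
    case True
    then have "A i 0 = 0"
      using i01 by (auto simp: A_def mmul2_def mat2_def Tm_def Qmat_def Qt_def alphaj_def numeral_2_eq_2)
    then show ?thesis by simp
  qed (use v in auto)
  moreover have "A i 1 = - (alpha_t p k * cosine_coeff (row_kernel n i) (k - p - 1))"
  proof -
    have Q: "Qt p lam alp pi n j k 1 = alpha_t p k * cosine_coeff (\<lambda>t. cos (rhoj p lam n j * of_real t)) (k - p - 1)" for j
      by (simp add: Qt_def alphaj_def rhoj_def rho_t_eq Dt_square)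
    show ?thesis
    proof (cases "i = 0")
      case False
      then have "A i 1 = - Qt p lam alp pi n 1 k 1"
        using i01 by (auto simp: A_def mmul2_def mat2_def Tm_def Qmat_def numeral_2_eq_2)
      also have "\<dots> = - (alpha_t p k * cosine_coeff (row_kernel n i) (k - p - 1))"
        unfolding Q using False by (simp add: rhoj_def row_kernel_def[abs_def])
      finally show ?thesis .
    next
      case True
      show ?thesis
      proof (cases "rho_hat p lam n = 0")
        case False
        then have "A i 1 = - ((Qt p lam alp pi n 0 k 1 - Qt p lam alp pi n 1 k 1) / rho_hat p lam n)"
          using True by (simp add: A_def mmul2_def mat2_def Tm_def Qmat_def numeral_2_eq_2 field_simps)
        also have "\<dots> = - (alpha_t p k * cosine_coeff (row_kernel n i) (k - p - 1))"
          unfolding Q using True False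
          by (simp add: rhoj_def row_kernel_def[abs_def] cosine_coeff_diff_quotient right_diff_distrib[symmetric])
        finally show ?thesis .
      next
        case hat: True
        then have "A i 1 = - deriv (\<lambda>r. alpha_t p k * Dt pi (r\<^sup>2) ((of_nat (k - p - 1))\<^sup>2)) (rho_of (lam n))"
          using True by (simp add: A_def mat2_def alphaj_def lamj_def lam_t_def rho_t_eq rhoj_def)
        then show ?thesis
          using True hat by (simp only: deriv_Dt_square row_kernel_def[abs_def]) simp
      qed
    qed
  qed
  ultimately show ?thesis
    unfolding H sum_mmul2_Tinv by (simp add: mult.assoc)
qed

text \<open>The integral of f against \<open>row_kernel\<close>, written through cosine coefficients
  by Parseval. It vanishes at \<open>n = 0\<close> and for \<open>i \<ge> 2\<close>, as
  \<open>mseq\<close> requires.\<close>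

definition null_vector :: "(nat \<Rightarrow> complex) \<Rightarrow> nat \<Rightarrow> nat \<Rightarrow> complex" where
  "null_vector f n i =
     (if n = 0 \<or> 2 \<le> i then 0
      else \<Sum>l. of_real (cosine_weight l) * (cosine_coeff (row_kernel n i) l * f l))"

context
  fixes f :: "nat \<Rightarrow> complex"
  assumes f2: "summable (\<lambda>l. (cmod (f l))\<^sup>2)"
begin

lemma summable_weighted_square: "summable (\<lambda>l. cosine_weight l * (cmod (f l))\<^sup>2)"
proof (rule summable_comparison_test[OF _ f2])
  have "cosine_weight l * (cmod (f l))\<^sup>2 \<le> (cmod (f l))\<^sup>2" for l
    using cosine_weight_bounds[of l] mult_right_mono[of "cosine_weight l" 1 "(cmod (f l))\<^sup>2"] by simp
  then show "\<exists>N. \<forall>l\<ge>N. norm (cosine_weight l * (cmod (f l))\<^sup>2) \<le> (cmod (f l))\<^sup>2"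
    using cosine_weight_pos by (auto simp: less_imp_le)
qed

lemma summable_norm_cosine_series:
  assumes "continuous_on {0..pi} h"
  shows "summable (\<lambda>l. cmod (of_real (cosine_weight l) * (cosine_coeff h l * f l)))"
proof (rule summable_comparison_test')
  show "summable (\<lambda>l. (cosine_weight l * (cmod (cosine_coeff h l))\<^sup>2 + cosine_weight l * (cmod (f l))\<^sup>2) / 2)"
    by (intro summable_divide summable_add summable_cosine_coeff_square assms summable_weighted_square)
  show "norm (cmod (of_real (cosine_weight l) * (cosine_coeff h l * f l)))
     \<le> (cosine_weight l * (cmod (cosine_coeff h l))\<^sup>2 + cosine_weight l * (cmod (f l))\<^sup>2) / 2" for l
    using norm_weighted_product_le[of l "cosine_coeff h" f] by (simp add: mult.assoc)
qed

text \<open>Used with the row kernels: the bound depends on \<open>h\<close> only through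
  \<open>C\<close>, hence is uniform over the rows.\<close>

lemma norm_cosine_series_le:
  assumes h: "continuous_on {0..pi} h" "\<And>t. t \<in> {0..pi} \<Longrightarrow> cmod (h t) \<le> C"
  shows "cmod (\<Sum>l. of_real (cosine_weight l) * (cosine_coeff h l * f l))
           \<le> (pi * C\<^sup>2 + (\<Sum>l. cosine_weight l * (cmod (f l))\<^sup>2)) / 2"
proof -
  let ?u = "\<lambda>l. cosine_weight l * (cmod (cosine_coeff h l))\<^sup>2" and ?v = "\<lambda>l. cosine_weight l * (cmod (f l))\<^sup>2"
  have u: "summable ?u" and v: "summable ?v"
    by (intro summable_cosine_coeff_square h summable_weighted_square)+
  have "cmod (\<Sum>l. of_real (cosine_weight l) * (cosine_coeff h l * f l))
        \<le> (\<Sum>l. cmod (of_real (cosine_weight l) * (cosine_coeff h l * f l)))"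
    by (intro summable_norm summable_norm_cosine_series h)
  also have "\<dots> \<le> (\<Sum>l. (?u l + ?v l) / 2)"
    using norm_weighted_product_le[of _ "cosine_coeff h" f]
    by (intro suminf_le summable_norm_cosine_series summable_divide summable_add u v h) (simp_all add: mult.assoc)
  also have "\<dots> = (suminf ?u + suminf ?v) / 2"
    using u v by (simp add: suminf_divide suminf_add summable_add)
  also have "suminf ?u \<le> pi * C\<^sup>2"
    by (intro suminf_le_const u bessel_cosine_coeff_bounded h)
  finally show ?thesis by simp
qed

lemma cosine_series_of_nat:
  "(\<Sum>l. of_real (cosine_weight l) * (cosine_coeff (\<lambda>t. cos (of_nat m * of_real t)) l * f l)) = f m"
proof -
  have "(\<lambda>l. of_real (cosine_weight l) * (cosine_coeff (\<lambda>t. cos (of_nat m * of_real t)) l * f l))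
      = (\<lambda>l. if l = m then f l else 0)"
    unfolding mult.assoc[symmetric] cosine_coeff_cos_of_nat by auto
  then show ?thesis
    using sums_single[of m f] by (simp add: sums_iff)
qed

lemma null_vector_Suc_0: "n \<ge> 1 \<Longrightarrow> null_vector f n 1 = f (n - p - 1)"
  using cosine_series_of_nat[of "n - p - 1"]
  by (simp add: null_vector_def row_kernel_def[abs_def] rho_t_eq)

text \<open>A divided difference times its step, plus the value at the model node, gives the value
  at \<open>rho_of (lam n)\<close>. If the nodes coincide, the derivative entry is multiplied by 0
  and the model value is already the right one.\<close>

lemma rho_hat_null_vector:
  assumes "n \<ge> 1"
  shows "rho_hat p lam n * null_vector f n 0 + null_vector f n 1
    = (\<Sum>l. of_real (cosine_weight l) * (cosine_coeff (\<lambda>t. cos (rho_of (lam n) * of_real t)) l * f l))"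
proof (cases "rho_hat p lam n = 0")
  case True
  then have "rho_of (lam n) = of_nat (n - p - 1)"
    by (simp add: rho_hat_def rho_t_eq)
  then show ?thesis
    using True assms by (simp only: null_vector_Suc_0 cosine_series_of_nat) simp
next
  case False
  let ?d = "rho_hat p lam n"
  let ?c = "\<lambda>z. cosine_coeff (\<lambda>t. cos (z * of_real t))"
  have s: "summable (\<lambda>l. of_real (cosine_weight l) * (?c z l * f l))" for z
    by (intro summable_norm_cancel[OF summable_norm_cosine_series] continuous_intros)
  have k: "summable (\<lambda>l. of_real (cosine_weight l) * (cosine_coeff (row_kernel n 0) l * f l))"
    by (intro summable_norm_cancel[OF summable_norm_cosine_series] continuous_row_kernel)
  have diff: "?d * cosine_coeff (row_kernel n 0) l = ?c (rho_of (lam n)) l - ?c (rho_t p n) l" for l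
    using False by (simp add: row_kernel_def[abs_def] cosine_coeff_diff_quotient)
  have kernel: "?d * (of_real (cosine_weight l) * (cosine_coeff (row_kernel n 0) l * f l))
      = of_real (cosine_weight l) * (?c (rho_of (lam n)) l * f l)
        - of_real (cosine_weight l) * (?c (rho_t p n) l * f l)" for l
    using diff[of l] by algebra
  have "?d * null_vector f n 0 = (\<Sum>l. ?d * (of_real (cosine_weight l) * (cosine_coeff (row_kernel n 0) l * f l)))"
    using assms k by (simp add: null_vector_def suminf_mult)
  also have "\<dots> = (\<Sum>l. of_real (cosine_weight l) * (?c (rho_of (lam n)) l * f l)
                       - of_real (cosine_weight l) * (?c (rho_t p n) l * f l))"
    unfolding kernel ..
  also have "\<dots> = (\<Sum>l. of_real (cosine_weight l) * (?c (rho_of (lam n)) l * f l))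
                   - (\<Sum>l. of_real (cosine_weight l) * (?c (rho_t p n) l * f l))"
    by (intro suminf_diff[symmetric] s)
  also have "(\<Sum>l. of_real (cosine_weight l) * (?c (rho_t p n) l * f l)) = null_vector f n 1"
    unfolding null_vector_Suc_0[OF assms] rho_t_eq by (rule cosine_series_of_nat)
  finally show ?thesis by simp
qed

text \<open>By \<open>Hblock_row_sum\<close> each row of the operator reduces to minus the cosine
  expansion of f paired with \<open>row_kernel\<close>, which is minus the same entry of the
  vector.\<close>

lemma EpH_null_vector:
  assumes orth: "\<And>n. n \<ge> 1 \<Longrightarrow> alp n \<noteq> 0 \<Longrightarrow>
    (\<Sum>l. of_real (cosine_weight l) * (cosine_coeff (\<lambda>t. cos (rho_of (lam n) * of_real t)) l * f l)) = 0"
  shows "EpH p lam alp pi (null_vector f) = (\<lambda>n i. 0)"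
proof (intro ext)
  fix n i
  show "EpH p lam alp pi (null_vector f) n i = 0"
  proof (cases "1 \<le> n \<and> i < 2")
    case True
    have "(\<Sum>j<2. Hblock p lam alp pi n (Suc k) i j * null_vector f (Suc k) j)
        = - (alpha_t p (Suc k) * (cosine_coeff (row_kernel n i) (Suc k - p - 1) * f (Suc k - p - 1)))" for k
    proof -
      have "alp (Suc k) * (rho_hat p lam (Suc k) * null_vector f (Suc k) 0 + null_vector f (Suc k) 1) = 0"
        using rho_hat_null_vector[of "Suc k"] orth[of "Suc k"] by (cases "alp (Suc k) = 0") auto
      from Hblock_row_sum[OF this, of i n] show ?thesis
        using True null_vector_Suc_0[of "Suc k"] by simp
    qed
    moreover have "(\<lambda>k. - (alpha_t p (Suc k) * (cosine_coeff (row_kernel n i) (Suc k - p - 1) * f (Suc k - p - 1))))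
        sums - null_vector f n i"
    proof -
      have "null_vector f n i = (\<Sum>l. of_real (cosine_weight l) * (cosine_coeff (row_kernel n i) l * f l))"
        using True by (simp add: null_vector_def)
      then show ?thesis
        by (simp only:) (intro sums_minus sums_alpha_t[where y = "\<lambda>l. cosine_coeff (row_kernel n i) l * f l"]
            summable_norm_cancel[OF summable_norm_cosine_series] continuous_row_kernel)
    qed
    ultimately show ?thesis
      using True by (simp add: EpH_def Hop_def sums_iff)
  qed (auto simp: EpH_def Hop_def null_vector_def)
qed

text \<open>The entries with \<open>i = 1\<close> are values of f, bounded by its l2 norm; those
  with \<open>i = 0\<close> are pairings with kernels that the strip bounds uniformly.\<close>

lemma mseq_null_vector:
  assumes Im: "\<And>n. n \<ge> 1 \<Longrightarrow> \<bar>Im (rho_of (lam n))\<bar> \<le> Y"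
  shows "mseq (null_vector f)"
proof -
  define B1 where "B1 = sqrt (\<Sum>l. (cmod (f l))\<^sup>2)"
  have B1: "cmod (f l) \<le> B1" for l
    unfolding B1_def by (rule norm_le_sqrt_suminf[OF f2])
  define B2 where "B2 = (pi * (pi * exp (pi * Y))\<^sup>2 + (\<Sum>l. cosine_weight l * (cmod (f l))\<^sup>2)) / 2"
  have "cmod (null_vector f n i) \<le> max 0 (max B1 B2)" for n i
  proof -
    consider "n = 0 \<or> 2 \<le> i" | "1 \<le> n" "i = 0" | "1 \<le> n" "i = 1" by linarith
    then show ?thesis
    proof cases
      case 2
      then have "cmod (null_vector f n i) \<le> B2"
        using norm_cosine_series_le[OF continuous_row_kernel norm_row_kernel_le[OF _ Im[OF 2(1)]]]
        by (simp add: null_vector_def B2_def)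
      then show ?thesis by simp
    next
      case 3
      then have "cmod (null_vector f n i) \<le> B1"
        using null_vector_Suc_0[of n] B1 by simp
      then show ?thesis by simp
    qed (simp add: null_vector_def)
  qed
  moreover have "null_vector f n i = 0" if "n = 0 \<or> 2 \<le> i" for n i
    using that by (auto simp: null_vector_def)
  ultimately show ?thesis
    unfolding mseq_def by blast
qed

end

end

text \<open>An inverse would have to send the zero sequence both to \<open>a\<close> and to
  0.\<close>

lemma not_invertible_on_m:
  assumes "mseq a" "EpH p lam alp x a = (\<lambda>n i. 0)" "a \<noteq> (\<lambda>n i. 0)"
  shows "\<not> invertible_on_m (EpH p lam alp x)"
proof
  assume "invertible_on_m (EpH p lam alp x)"
  then obtain G where G: "\<And>a. mseq a \<Longrightarrow> G (EpH p lam alp x a) = a"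
    unfolding invertible_on_m_def by blast
  have "mseq (\<lambda>n i. 0)"
    by (auto simp: mseq_def)
  moreover have "EpH p lam alp x (\<lambda>n i. 0) = (\<lambda>n i. 0)"
    by (intro ext) (simp add: EpH_def Hop_def)
  ultimately show False
    using G[of a] G[of "\<lambda>n i. 0"] assms by metis
qed

theorem theorem5p1:
  fixes p :: nat and lam alp :: "nat \<Rightarrow> complex"
  assumes "in_Sp p lam alp"
    and "A_S alp + B_S lam alp \<ge> p + 1"
  shows "\<not> invertible_on_m (EpH p lam alp pi)"
proof -
  obtain vk :: "nat \<Rightarrow> complex" where vk: "summable (\<lambda>n. (cmod (vk n))\<^sup>2)"
    and rho: "\<And>n. n \<ge> 1 \<Longrightarrow> rho_of (lam n) = of_int (int n - int p - 1) + vk n"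
    using assms(1) unfolding in_Sp_def by blast
  \<comment> \<open>Only \<open>vk\<close> contributes to the imaginary part of the nodes, so its l2
    norm gives a strip containing all of them.\<close>
  define Y where "Y = sqrt (\<Sum>n. (cmod (vk n))\<^sup>2)"
  have Y: "\<bar>Im (vk n)\<bar> \<le> Y" for n
    unfolding Y_def using abs_Im_le_cmod norm_le_sqrt_suminf[OF vk] by (rule order.trans)
  have Im: "\<bar>Im (rho_of (lam n))\<bar> \<le> Y" if "n \<ge> 1" for n
    using Y[of n] rho[OF that] by simp
  obtain N where N: "N \<ge> p + 1"
    and card: "card (lam ` {n \<in> {1..N}. alp n \<noteq> 0}) + (A_S alp + B_S lam alp) \<le> N"
    using card_distinct_nodes_le[of lam alp] by (meson max.cobounded1 max.cobounded2)
  \<comment> \<open>At most N - (p + 1) distinct nodes are left among the first \<open>N\<close>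
    indices, so \<open>M\<close> bounds \<open>card R\<close>; with the shift m = n - p - 1, the
    indices n > N become exactly m > M.\<close>
  define M where "M = N - p - 1"
  define R where "R = rho_of ` lam ` {n \<in> {1..N}. alp n \<noteq> 0}"
  define nu where "nu m = rho_of (lam (m + p + 1))" for m
  have R: "finite R" "card R \<le> M"
    using card assms(2) card_image_le[of "lam ` {n \<in> {1..N}. alp n \<noteq> 0}" rho_of]
    by (auto simp: R_def M_def)
  have nu_diff: "nu m - of_nat m = vk (m + (p + 1))" for m
    using rho[of "m + p + 1"] by (simp add: nu_def)
  have "summable (\<lambda>m. (cmod (nu m - of_nat m))\<^sup>2)"
    unfolding nu_diff using vk by (rule summable_ignore_initial_segment)
  from exists_sequence_orthogonal_to_cosines[OF R _ this, of Y] Im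
  obtain f where f: "summable (\<lambda>l. (cmod (f l))\<^sup>2)" "\<exists>l. f l \<noteq> 0"
    and orth: "\<And>z. z \<in> R \<union> nu ` {M<..} \<Longrightarrow>
      (\<Sum>l. of_real (cosine_weight l) * cosine_coeff (\<lambda>t. cos (z * of_real t)) l * f l) = 0"
    by (auto simp: nu_def)
  \<comment> \<open>The orthogonality conditions cover every index with nonzero
    \<open>alp n\<close>: small ones through \<open>R\<close>, large ones through
    \<open>nu\<close>.\<close>
  have "rho_of (lam n) \<in> R \<union> nu ` {M<..}" if "n \<ge> 1" "alp n \<noteq> 0" for n
  proof (cases "n \<le> N")
    case False
    then have "n = (n - p - 1) + p + 1" "M < n - p - 1"
      using N by (auto simp: M_def)
    then have "rho_of (lam n) = nu (n - p - 1)" "n - p - 1 \<in> {M<..}"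
      by (auto simp: nu_def)
    then show ?thesis by blast
  qed (use that in \<open>auto simp: R_def\<close>)
  then have "EpH p lam alp pi (null_vector p lam f) = (\<lambda>n i. 0)"
    using f(1) orth by (intro EpH_null_vector) (simp_all add: mult.assoc)
  moreover have "mseq (null_vector p lam f)"
    using f(1) Im by (rule mseq_null_vector)
  moreover have "null_vector p lam f \<noteq> (\<lambda>n i. 0)"
  proof -
    obtain l where "f l \<noteq> 0" using f(2) by blast
    \<comment> \<open>The coefficient \<open>f l\<close> appears unchanged as the model component at
      index l + p + 1.\<close>
    then have "null_vector p lam f (l + p + 1) 1 \<noteq> 0"
      by (subst null_vector_Suc_0[OF f(1)]) auto
    then show ?thesis by metis
  qed
  ultimately show ?thesis
    by (intro not_invertible_on_m)
qed

end
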